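(* Let $g(t)=\sum_{n\ge0}g_nt^n$ and $f(t)=\sum_{n\ge1}f_nt^n$ be formal power series with $g_0=1$ and $f_1\neq0$, and let $(d_{n,k})_{n,k\ge0}=(g,f)$ be the associated Riordan array, i.e. $d_{n,k}=[t^n]\,g(t)f(t)^k$ (with $d_{n,k}=0$ whenever $n<0$). Fix integers $p\ge1$ and $r\ge0$, and let $\phi(t)$ be the compositional inverse of the series $t^p/f(t)^{p-1}$. Then the matrix $(\widehat d_{n,k})_{n,k\ge0}$ with $\widehat d_{n,k}=d_{pn+r-k,\,(p-1)n+r}$ is a Riordan array, namely $$(\widehat d_{n,k})_{n,k\ge0}=\left(\frac{t\,\phi'(t)\,g(\phi(t))\,f(\phi(t))^r}{\phi(t)^{r+1}},\ \phi(t)\right).$$ In particular, for $p=1,r=0$ it is the Toeplitz matrix $(d_{n-k,0})_{n,k\ge0}$ of the $0$th column of $(g,f)$, and for $p=2,r=0$ it is the vertical half Riordan array $(d_{2n-k,n})_{n,k\ge0}$. Moreover, if $A(t)$ denotes the generating function of the $A$-sequence of $(g,f)$, then the generating function of the $A$-sequence of $(\widehat d_{n,k})$ is $(A(f(t)))^{p-1}=(f(t)/t)^{p-1}$.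
   Context: A Riordan array $(g,f)$, for $g(0)=1$, $f(0)=0$, $f'(0)\neq0$, is the infinite lower triangular matrix whose $(n,k)$ entry is $[t^n]g(t)f(t)^k$. The $A$-sequence of $(g,f)$ is the sequence $(a_n)_{n\ge0}$ whose generating function $A(t)=\sum_{n\ge0}a_nt^n$ is determined by $f(t)=t\,A(f(t))$. For a series $h$ with $h(0)=0$, $h'(0)\neq0$, $\bar h$ denotes its compositional inverse.
   Formalization: "Riordan array" is taken with g(0) nonzero instead of g(0)=1, since the new array has (0,0) entry f_1^r (for g=1, f=2t, p=r=1 it is 2); this constant term is proved as well, so the normalised claim follows when f_1^r=1. *)

theory Defs
  imports "HOL-Computational_Algebra.Formal_Power_Series"
begin

unbundle fps_syntax

definition riordan :: "'a::field fps \<Rightarrow> 'a fps \<Rightarrow> nat \<Rightarrow> nat \<Rightarrow> 'a" where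
  "riordan g f n k = (g * f ^ k) $ n"

text \<open>Row index extended to the integers, with zero entries in negative rows.\<close>

definition riordan_int :: "'a::field fps \<Rightarrow> 'a fps \<Rightarrow> int \<Rightarrow> nat \<Rightarrow> 'a" where
  "riordan_int g f n k = (if n < 0 then 0 else riordan g f (nat n) k)"

text \<open>
  The first series is only required to be a unit. Many authors normalise it to have constant
  term 1, but that normalisation is not preserved by the transformations
  considered here: the entry in position \<open>(0,0)\<close> of the transformed array
  is \<open>(f $ 1) ^ r\<close>.
\<close>

definition riordan_pair :: "'a::field fps \<Rightarrow> 'a fps \<Rightarrow> bool" where
  "riordan_pair g f \<longleftrightarrow> g $ 0 \<noteq> 0 \<and> f $ 0 = 0 \<and> f $ 1 \<noteq> 0"

definition is_riordan_array :: "(nat \<Rightarrow> nat \<Rightarrow> 'a::field) \<Rightarrow> bool" where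
  "is_riordan_array D \<longleftrightarrow> (\<exists>g f. riordan_pair g f \<and> D = riordan g f)"

definition A_series :: "(nat \<Rightarrow> nat \<Rightarrow> 'a::field) \<Rightarrow> 'a fps" where
  "A_series D = (THE A. \<exists>g f. riordan_pair g f \<and> D = riordan g f \<and> f = fps_X * (A oo f))"

lemma riordan_pair_unique:
  assumes "riordan_pair g f" "riordan g f = riordan g' f'"
  shows "g = g'" "f = f'"
proof -
  have *: "g * f ^ k = g' * f' ^ k" for k
    using assms(2) by (intro fps_ext) (metis riordan_def)
  from *[of 0] show g: "g = g'" by simp
  have "g \<noteq> 0" using assms(1) by (auto simp: riordan_pair_def)
  with *[of 1] g show "f = f'" by simp
qed

lemma A_series_unique:
  fixes f A :: "'a::field fps"
  assumes "f $ 0 = 0" "f $ 1 \<noteq> 0" "f = fps_X * (A oo f)"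
  shows "A = fps_shift 1 f oo fps_inv f"
proof -
  have "fps_shift 1 f = A oo f"
    by (subst assms(3)) (simp add: fps_eq_iff)
  then have "fps_shift 1 f oo fps_inv f = A oo (f oo fps_inv f)"
    using assms by (simp add: fps_compose_assoc fps_inv_def)
  also have "\<dots> = A"
    using assms by (simp add: fps_inv_right)
  finally show ?thesis ..
qed

lemma A_series_exists:
  fixes f :: "'a::field fps"
  assumes "f $ 0 = 0" "f $ 1 \<noteq> 0"
  shows "f = fps_X * ((fps_shift 1 f oo fps_inv f) oo f)"
proof -
  have "(fps_shift 1 f oo fps_inv f) oo f = fps_shift 1 f oo (fps_inv f oo f)"
    using assms by (simp add: fps_compose_assoc fps_inv_def)
  also have "\<dots> = fps_shift 1 f"
    using assms by (simp add: fps_inv)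
  finally show ?thesis
    using assms(1) by (simp add: fps_eq_iff)
qed

lemma A_series_riordan:
  assumes "riordan_pair g f"
  shows "A_series (riordan g f) = A \<longleftrightarrow> f = fps_X * (A oo f)"
proof -
  have f: "f $ 0 = 0" "f $ 1 \<noteq> 0"
    using assms by (auto simp: riordan_pair_def)
  have iff: "(\<exists>g' f'. riordan_pair g' f' \<and> riordan g f = riordan g' f' \<and> f' = fps_X * (B oo f'))
      \<longleftrightarrow> f = fps_X * (B oo f)" for B
    using assms riordan_pair_unique by metis
  have "A_series (riordan g f) = fps_shift 1 f oo fps_inv f"
    unfolding A_series_def iff
    using A_series_exists[OF f] A_series_unique[OF f] by (intro the_equality)
  then show ?thesis
    using A_series_exists[OF f] A_series_unique[OF f] by metis
qed

definition toeplitz :: "(nat \<Rightarrow> 'a::zero) \<Rightarrow> nat \<Rightarrow> nat \<Rightarrow> 'a" where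
  "toeplitz c n k = (if k \<le> n then c (n - k) else 0)"

definition vertical_half :: "'a::field fps \<Rightarrow> 'a fps \<Rightarrow> nat \<Rightarrow> nat \<Rightarrow> 'a" where
  "vertical_half g f n k = riordan_int g f (2 * int n - int k) n"

end

theory Submission
  imports Defs
begin

text \<open>
  Write f = X u and w = u ^ (p - 1), so that \<open>\<phi>\<close> is the compositional inverse of h = X / w and
  satisfies \<open>\<phi> = X (w oo \<phi>)\<close>. Cancelling powers of \<open>\<phi>\<close> turns the proposed first component
  into \<open>\<phi>' ((g u ^ r / w) oo \<phi>)\<close>. The Lagrange inversion formula
  \<open>[t\<^sup>n] \<phi>' (F oo \<phi>) = [t\<^sup>n] F w ^ (n + 1)\<close> then evaluates the (n,k) entry of the Riordan
  array to \<open>[t ^ (n - k)] g u ^ ((p - 1) n + r)\<close>, which is the required entry of (g, f).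
\<close>

text \<open>Since \<open>h\<close> has no constant term, \<open>h ^ i\<close> starts in degree at
  least i. The sums for all coefficients of \<open>c oo h\<close> up to degree n can thus be
  extended to the common range \<open>i \<le> n\<close> and interchanged with the
  convolution.\<close>

lemma fps_compose_mult_nth:
  fixes c h q :: "'a::comm_ring_1 fps"
  assumes "h $ 0 = 0"
  shows "((c oo h) * q) $ n = (\<Sum>i\<le>n. c $ i * (h ^ i * q) $ n)"
proof -
  have "(c oo h) $ j = (\<Sum>i\<le>n. c $ i * h ^ i $ j)" if "j \<le> n" for j
    unfolding fps_compose_nth
    using that startsby_zero_power_prefix[OF assms] by (intro sum.mono_neutral_left) auto
  then have "((c oo h) * q) $ n = (\<Sum>j=0..n. \<Sum>i\<le>n. c $ i * h ^ i $ j * q $ (n - j))"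
    by (simp add: fps_mult_nth sum_distrib_right)
  also have "\<dots> = (\<Sum>i\<le>n. c $ i * (h ^ i * q) $ n)"
    by (subst sum.swap) (simp add: fps_mult_nth sum_distrib_left mult.assoc)
  finally show ?thesis .
qed

text \<open>As w = X / h, this coefficient is the residue of h' / h ^ (N + 1). For N > 0 that is the
  derivative of -1 / (N h ^ N), so its residue vanishes; the proof stays within power
  series.\<close>

lemma fps_deriv_mult_power_nth:
  fixes h w :: "'a::field_char_0 fps"
  assumes "h $ 0 = 0" "h * w = fps_X"
  shows "(fps_deriv h * w ^ Suc N) $ N = (if N = 0 then 1 else 0)"
proof -
  have "fps_deriv (h * w) = 1"
    using assms by simp
  then have dh: "fps_deriv h * w = 1 - h * fps_deriv w"
    by (simp add: algebra_simps)
  show ?thesis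
  proof (cases N)
    case 0
    then show ?thesis
      using assms(1) dh by simp
  next
    case (Suc M)
    have "fps_deriv h * w ^ Suc N = (1 - h * fps_deriv w) * w ^ N"
      by (simp add: dh[symmetric] mult.assoc)
    also have "\<dots> = w ^ N - (h * w) * (fps_deriv w * w ^ M)"
      by (simp add: Suc algebra_simps)
    finally have "fps_deriv h * w ^ Suc N = w ^ N - fps_X * (fps_deriv w * w ^ M)"
      by (simp add: assms)
    \<comment> \<open>The coefficient of (w ^ N)' in degree M = N - 1 is computed by the power rule
      and directly; characteristic zero lets the factor N cancel.\<close>
    moreover have "fps_deriv (w ^ N) $ M = of_nat N * (fps_deriv w * w ^ M) $ M"
      by (simp add: fps_deriv_power Suc mult.assoc del: power_Suc of_nat_Suc)
    then have "of_nat N * (w ^ N) $ N = of_nat N * (fps_deriv w * w ^ M) $ M"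
      by (simp add: Suc del: power_Suc of_nat_Suc)
    then have "(w ^ N) $ N = (fps_deriv w * w ^ M) $ M"
      by (simp add: Suc del: power_Suc of_nat_Suc)
    ultimately show ?thesis
      by (simp add: Suc)
  qed
qed

text \<open>
  Expanding \<open>F / h'\<close> in powers of h reduces the formula to \<open>F = h ^ i h'\<close>, where
  \<open>h ^ i w ^ (n + 1) = X ^ i w ^ (n - i + 1)\<close>.
\<close>

lemma fps_lagrange_inversion:
  fixes F h w :: "'a::field_char_0 fps"
  assumes h0: "h $ 0 = 0" and h1: "h $ 1 \<noteq> 0" and hw: "h * w = fps_X"
  shows "(fps_deriv (fps_inv h) * (F oo fps_inv h)) $ n = (F * w ^ Suc n) $ n"
proof -
  define \<phi> where "\<phi> = fps_inv h"
  define H where "H = F * inverse (fps_deriv h)"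
  define c where "c = H oo \<phi>"
  have \<phi>0: "\<phi> $ 0 = 0"
    by (simp add: \<phi>_def fps_inv_def)
  have F: "F = H * fps_deriv h"
    using h1 by (simp add: H_def mult.assoc inverse_mult_eq_1)
  have H: "H = c oo h"
    using h0 h1 \<phi>0 by (simp add: c_def \<phi>_def fps_compose_assoc[symmetric] fps_inv)
  \<comment> \<open>The chain rule for \<open>h oo \<phi> = fps_X\<close> cancels h', so the left
    side of the claim is \<open>c $ n\<close>.\<close>
  have "(fps_deriv h oo \<phi>) * fps_deriv \<phi> = 1"
    using fps_compose_deriv[OF \<phi>0, of h] h0 h1 by (simp add: \<phi>_def fps_inv_right)
  then have "fps_deriv \<phi> * (F oo \<phi>) = c"
    by (simp add: F c_def fps_compose_mult_distrib[OF \<phi>0] algebra_simps)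
  moreover have "(F * w ^ Suc n) $ n = c $ n"
  proof -
    have summand: "(h ^ i * (fps_deriv h * w ^ Suc n)) $ n = (if i = n then 1 else 0)"
      if "i \<le> n" for i
    proof -
      have "w ^ Suc n = w ^ i * w ^ Suc (n - i)"
        using that by (simp flip: power_add power_Suc)
      then have "h ^ i * (fps_deriv h * w ^ Suc n) = fps_X ^ i * (fps_deriv h * w ^ Suc (n - i))"
        by (simp add: hw[symmetric] power_mult_distrib mult_ac del: power_Suc)
      then show ?thesis
        using that by (simp only: fps_X_power_mult_nth fps_deriv_mult_power_nth[OF h0 hw]) auto
    qed
    have "(F * w ^ Suc n) $ n = ((c oo h) * (fps_deriv h * w ^ Suc n)) $ n"
      by (simp only: F H mult.assoc)
    also have "\<dots> = (\<Sum>i\<le>n. if i = n then c $ i else 0)"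
      unfolding fps_compose_mult_nth[OF h0] using summand by (intro sum.cong) auto
    finally show ?thesis
      by simp
  qed
  ultimately show ?thesis
    by (simp add: \<phi>_def)
qed

theorem theorem2p1:
  fixes g f \<phi> ghat :: "'a::field_char_0 fps"
    and dhat :: "nat \<Rightarrow> nat \<Rightarrow> 'a"
    and p r :: nat
  assumes "g $ 0 = 1" and "f $ 0 = 0" and "f $ 1 \<noteq> 0"
    and "p \<ge> 1"
    and "\<phi> = fps_inv (fps_X ^ p / f ^ (p - 1))"
    and "ghat = (fps_X * fps_deriv \<phi> * (g oo \<phi>) * (f oo \<phi>) ^ r) / \<phi> ^ (r + 1)"
    and "dhat = (\<lambda>n k. riordan_int g f (int p * int n + int r - int k) ((p - 1) * n + r))"
  shows "is_riordan_array dhat \<and> riordan_pair ghat \<phi> \<and> dhat = riordan ghat \<phi>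
    \<and> ghat $ 0 = (f $ 1) ^ r
    \<and> (p = 1 \<and> r = 0 \<longrightarrow> dhat = toeplitz (\<lambda>n. riordan g f n 0))
    \<and> (p = 2 \<and> r = 0 \<longrightarrow> dhat = vertical_half g f)
    \<and> A_series dhat = (A_series (riordan g f) oo f) ^ (p - 1)
    \<and> (A_series (riordan g f) oo f) ^ (p - 1) = (f / fps_X) ^ (p - 1)"
proof -
  define u where "u = fps_shift 1 f"
  define w where "w = u ^ (p - 1)"
  define h where "h = fps_X * inverse w"
  define v where "v = w oo \<phi>"
  have f: "f = fps_X * u"
    using assms(2) by (simp add: u_def fps_eq_iff)
  have u0: "u $ 0 = f $ 1"
    by (simp add: u_def)
  have w0: "w $ 0 \<noteq> 0"
    using assms(3) by (simp add: w_def u0)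
  have p: "p = Suc (p - 1)"
    using assms(4) by simp
  have h0: "h $ 0 = 0" and h1: "h $ 1 \<noteq> 0" and hw: "h * w = fps_X"
    using w0 by (simp_all add: h_def mult.assoc inverse_mult_eq_1)
  have "f \<noteq> 0"
    using assms(3) by auto
  \<comment> \<open>The quotient defining \<open>\<phi>\<close> is an exact division with value
    \<open>h\<close>.\<close>
  have "fps_X ^ p = fps_X ^ (p - 1) * (h * w)"
    unfolding hw by (subst p) simp
  also have "\<dots> = h * f ^ (p - 1)"
    by (simp add: f w_def power_mult_distrib mult_ac)
  finally have \<phi>: "\<phi> = fps_inv h"
    using \<open>f \<noteq> 0\<close> assms(5) by simp
  have \<phi>0: "\<phi> $ 0 = 0"
    by (simp add: \<phi> fps_inv_def)
  have v0: "v $ 0 = w $ 0"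
    by (simp add: v_def)
  have \<phi>X: "\<phi> = fps_X * v"
    using arg_cong[OF hw, of "\<lambda>a. a oo \<phi>"] h0 h1 \<phi>0
    by (simp add: fps_compose_mult_distrib \<phi> fps_inv_right v_def)
  have \<phi>1: "\<phi> $ 1 = w $ 0"
    by (subst \<phi>X) (simp add: v0)
  have "\<phi> \<noteq> 0"
    using \<phi>1 w0 by auto
  have ghat: "ghat = fps_deriv \<phi> * ((g * u ^ r * inverse w) oo \<phi>)"
  proof -
    have "(inverse w oo \<phi>) * v = 1"
      using w0 v0 by (simp add: v_def fps_inverse_compose[OF \<phi>0] inverse_mult_eq_1)
    \<comment> \<open>The numerator of \<open>ghat\<close> contains r + 1 factors
      \<open>\<phi>\<close>: one from \<open>fps_X\<close>, and r from the power of
      \<open>f oo \<phi>\<close>.\<close>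
    then have "fps_X = \<phi> * (inverse w oo \<phi>)"
      by (subst \<phi>X) (simp add: mult_ac)
    moreover have "f oo \<phi> = \<phi> * (u oo \<phi>)"
      by (simp add: f fps_compose_mult_distrib[OF \<phi>0] \<phi>0)
    ultimately have "fps_X * fps_deriv \<phi> * (g oo \<phi>) * (f oo \<phi>) ^ r
        = (fps_deriv \<phi> * ((g * u ^ r * inverse w) oo \<phi>)) * \<phi> ^ (r + 1)"
      by (simp add: fps_compose_mult_distrib[OF \<phi>0] fps_compose_power[OF \<phi>0]
          power_mult_distrib mult_ac)
    then show ?thesis
      using \<open>\<phi> \<noteq> 0\<close> by (simp only: assms(6) nonzero_mult_div_cancel_right power_not_zero not_False_eq_True)
  qed
  have ghat0: "ghat $ 0 = (f $ 1) ^ r"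
    using \<phi>1 w0 assms(1) by (simp add: ghat u0 fps_power_zeroth)
  have pair: "riordan_pair ghat \<phi>"
    using ghat0 \<phi>0 \<phi>1 w0 assms(3) by (simp add: riordan_pair_def)
  have entry: "dhat n k = riordan ghat \<phi> n k" for n k
  proof -
    define m where "m = (p - 1) * n + r"
    have um: "u ^ m = w ^ n * u ^ r"
      by (simp add: m_def w_def power_add power_mult)
    have "riordan ghat \<phi> n k
        = (fps_deriv \<phi> * ((g * u ^ r * inverse w * fps_X ^ k) oo \<phi>)) $ n"
      by (simp add: riordan_def ghat fps_compose_mult_distrib[OF \<phi>0]
          fps_compose_power[OF \<phi>0, symmetric] \<phi>0 mult.assoc)
    also have "\<dots> = (g * u ^ r * inverse w * fps_X ^ k * w ^ Suc n) $ n"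
      unfolding \<phi> by (rule fps_lagrange_inversion[OF h0 h1 hw])
    also have "g * u ^ r * inverse w * fps_X ^ k * w ^ Suc n
        = fps_X ^ k * (g * u ^ m) * (inverse w * w)"
      by (simp add: um mult_ac)
    finally have L: "riordan ghat \<phi> n k = (if n < k then 0 else (g * u ^ m) $ (n - k))"
      using w0 by (simp add: inverse_mult_eq_1 fps_X_power_mult_nth)
    have "g * f ^ m = fps_X ^ m * (g * u ^ m)"
      by (simp add: f power_mult_distrib mult_ac)
    then have R: "riordan g f j m = (if j < m then 0 else (g * u ^ m) $ (j - m))" for j
      by (simp only: riordan_def fps_X_power_mult_nth)
    have "int p * int n + int r = int m + int n"
      using assms(4) by (cases p) (simp_all add: m_def algebra_simps)
    then have "dhat n k = riordan_int g f (int m + int n - int k) m"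
      by (simp only: assms(7) flip: m_def)
    \<comment> \<open>For n < k both sides vanish: row m + n - k is either negative or above the
      diagonal of column m. Otherwise both read degree n - k.\<close>
    then show ?thesis
      by (auto simp: L R riordan_int_def nat_diff_distrib nat_add_distrib
          intro!: arg_cong[of _ _ "\<lambda>j. (g * u ^ m) $ j"])
  qed
  then have dhat: "dhat = riordan ghat \<phi>"
    by blast
  have "riordan_pair g f"
    using assms(1-3) by (simp add: riordan_pair_def)
  then have "f = fps_X * (A_series (riordan g f) oo f)"
    using A_series_riordan by blast
  then have A: "A_series (riordan g f) oo f = u"
    by (subst (asm) f, subst (asm) mult_left_cancel) auto
  \<comment> \<open>The relation \<open>\<phi> = fps_X * (w oo \<phi>)\<close> is the defining
    equation of the A-sequence.\<close>
  have "A_series dhat = w"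
    unfolding dhat A_series_riordan[OF pair] using \<phi>X v_def by simp
  moreover have "f / fps_X = u"
    by (simp add: u_def)
  moreover have "dhat = toeplitz (\<lambda>n. riordan g f n 0)" if "p = 1 \<and> r = 0"
    using that by (auto simp: assms(7) toeplitz_def riordan_int_def fun_eq_iff of_nat_diff nat_diff_distrib)
  moreover have "dhat = vertical_half g f" if "p = 2 \<and> r = 0"
    using that by (simp add: assms(7) vertical_half_def fun_eq_iff)
  ultimately show ?thesis
    using pair dhat ghat0 A by (auto simp: is_riordan_array_def w_def)
qed

end
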